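(* Let $\alpha,\beta_0,\beta_1,d$ be positive integers, let $r$ be a nonnegative integer, and let $p_m$ and $q_m$ be the numerators and denominators of the convergents $p_m/q_m$ of the continued fraction $\xi(\alpha,\beta_0,\beta_1,d,r)$. Let $$\sigma=\frac{\beta_0-\alpha}{\beta_1}+\frac{L_d(\alpha)}{\beta_1F_d(\alpha)},\qquad \rho=\frac{(-1)^{d-1}}{\beta_1^2F_d(\alpha)^2}.$$ Then for every integer $n\ge 0$ the $(nd+r-1)$st convergent of $\xi(\alpha,\beta_0,\beta_1,d,r)$ is $p_{nd+r-1}/q_{nd+r-1}$, where $$\frac{p_{nd+r-1}}{F_d(\alpha)^n\beta_1^n}=F_{r+1}(\alpha)\sum_{k=0}^{\lfloor n/2\rfloor}\frac{(n-k)!}{k!}\binom{n+\sigma-1-k}{n-2k}\rho^k+(-1)^{d-r}F_{d-r-1}(\alpha)F_d(\alpha)\beta_1\sum_{k=0}^{\lfloor (n-1)/2\rfloor}\frac{(n-k-1)!}{k!}\binom{n+\sigma-1-k}{n-2k-1}\rho^{k+1}$$ and $$\frac{q_{nd+r-1}}{F_d(\alpha)^n\beta_1^n}=F_{r}(\alpha)\sum_{k=0}^{\lfloor n/2\rfloor}\frac{(n-k)!}{k!}\binom{n+\sigma-1-k}{n-2k}\rho^k+(-1)^{d+1-r}F_{d-r}(\alpha)F_d(\alpha)\beta_1\sum_{k=0}^{\lfloor (n-1)/2\rfloor}\frac{(n-k-1)!}{k!}\binom{n+\sigma-1-k}{n-2k-1}\rho^{k+1}.$$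
   Context: Continued fraction: $\xi(\alpha,\beta_0,\beta_1,d,r)=[a_0,a_1,a_2,\ldots]$ is the infinite simple continued fraction $[\underbrace{\alpha,\ldots,\alpha}_r,\beta_0,\overline{\underbrace{\alpha,\ldots,\alpha,\beta_0+\beta_1 n}_d}]_{n=1}^\infty$; that is, $a_{r+jd}=\beta_0+\beta_1 j$ for all integers $j\ge 0$, and $a_i=\alpha$ for every other index $i\ge 0$. Convergents: $p_m,q_m$ are defined by $p_{-1}=1$, $p_0=a_0$, $q_{-1}=0$, $q_0=1$ and $p_m=a_mp_{m-1}+p_{m-2}$, $q_m=a_mq_{m-1}+q_{m-2}$ for $m\ge1$, so that $[a_0,\ldots,a_m]=p_m/q_m$ for $m\geq 0$. (For $n=r=0$ the index $nd+r-1$ is $-1$ and the formulas refer to $p_{-1}=1$, $q_{-1}=0$.) Fibonacci and Lucas polynomials: $F_0(q)=0$, $F_1(q)=1$, $L_0(q)=2$, $L_1(q)=q$, and $X_n(q)=qX_{n-1}(q)+X_{n-2}(q)$ for $X\in\{F,L\}$. The sequence $F_n$ is extended to negative indices by the same recurrence (equivalently $F_{-n}(q)=(-1)^{n+1}F_n(q)$). Binomial coefficients: for real $x$ and an integer $j\ge0$, $\binom{x}{j}=x(x-1)\cdots(x-j+1)/j!$. Empty sums (upper limit $-1$) are $0$. *)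

theory Defs
  imports Complex_Main "HOL-Computational_Algebra.Polynomial"
begin

text \<open>
  A simple continued fraction \<open>[a\<^sub>0, a\<^sub>1, a\<^sub>2, \<dots>]\<close> is given by its sequence of partial quotients.
  This is \<open>\<xi>(\<alpha>, \<beta>\<^sub>0, \<beta>\<^sub>1, d, r)\<close>: the entry at index \<open>r + j d\<close> is \<open>\<beta>\<^sub>0 + \<beta>\<^sub>1 j\<close>, all others are \<open>\<alpha>\<close>.
\<close>
definition xi :: "int \<Rightarrow> int \<Rightarrow> int \<Rightarrow> nat \<Rightarrow> nat \<Rightarrow> nat \<Rightarrow> int" where
  "xi \<alpha> \<beta>\<^sub>0 \<beta>\<^sub>1 d r i =
     (if r \<le> i \<and> d dvd (i - r) then \<beta>\<^sub>0 + \<beta>\<^sub>1 * int ((i - r) div d) else \<alpha>)"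

lemma xi_special: "d > 0 \<Longrightarrow> xi \<alpha> \<beta>\<^sub>0 \<beta>\<^sub>1 d r (r + j * d) = \<beta>\<^sub>0 + \<beta>\<^sub>1 * int j"
  by (simp add: xi_def)

lemma xi_other: "\<forall>j. i \<noteq> r + j * d \<Longrightarrow> xi \<alpha> \<beta>\<^sub>0 \<beta>\<^sub>1 d r i = \<alpha>"
  unfolding xi_def by (metis dvd_def le_add_diff_inverse mult.commute)

text \<open>The value of the finite continued fraction \<open>[x\<^sub>0, \<dots>, x\<^sub>m]\<close>; the empty list is a dummy case.\<close>
fun cfrac_value :: "real list \<Rightarrow> real" where
  "cfrac_value [] = 0"
| "cfrac_value [x] = x"
| "cfrac_value (x # y # ys) = x + 1 / cfrac_value (y # ys)"

definition convergent_of :: "(nat \<Rightarrow> int) \<Rightarrow> nat \<Rightarrow> real" where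
  "convergent_of a m = cfrac_value (map (\<lambda>i. of_int (a i)) [0..<Suc m])"

text \<open>
  Numerators and denominators, indexed by integers \<open>\<ge> -1\<close>.
  The value \<open>0\<close> below \<open>-1\<close> is a dummy; the recurrence is only meant for \<open>m \<ge> 1\<close>.
\<close>
function cfrac_num :: "(nat \<Rightarrow> int) \<Rightarrow> int \<Rightarrow> int" where
  "cfrac_num a m =
     (if m < -1 then 0 else if m = -1 then 1 else if m = 0 then a 0
      else a (nat m) * cfrac_num a (m - 1) + cfrac_num a (m - 2))"
  by pat_completeness auto
termination by (relation "measure (\<lambda>(a, m). nat (m + 2))") auto

function cfrac_den :: "(nat \<Rightarrow> int) \<Rightarrow> int \<Rightarrow> int" where
  "cfrac_den a m =
     (if m < -1 then 0 else if m = -1 then 0 else if m = 0 then 1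
      else a (nat m) * cfrac_den a (m - 1) + cfrac_den a (m - 2))"
  by pat_completeness auto
termination by (relation "measure (\<lambda>(a, m). nat (m + 2))") auto

text \<open>
  Fibonacci polynomials, extended to negative indices by running the recurrence backwards.
\<close>
function fib_poly :: "int \<Rightarrow> 'a::comm_ring_1 poly" where
  "fib_poly n =
     (if n = 0 then 0 else if n = 1 then 1
      else if n > 1 then [:0, 1:] * fib_poly (n - 1) + fib_poly (n - 2)
      else fib_poly (n + 2) - [:0, 1:] * fib_poly (n + 1))"
  by pat_completeness auto
termination by (relation "measure (\<lambda>n. nat \<bar>2 * n - 1\<bar>)") auto

fun lucas_poly :: "nat \<Rightarrow> 'a::comm_ring_1 poly" where
  "lucas_poly 0 = 2"
| "lucas_poly (Suc 0) = [:0, 1:]"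
| "lucas_poly (Suc (Suc n)) = [:0, 1:] * lucas_poly (Suc n) + lucas_poly n"

declare cfrac_num.simps [simp del] cfrac_den.simps [simp del] fib_poly.simps [simp del]

lemma fib_poly_0_1: "fib_poly 0 = 0" "fib_poly 1 = 1"
  by (simp_all add: fib_poly.simps)

lemma fib_poly_rec:
  "fib_poly n = [:0, 1:] * fib_poly (n - 1) + (fib_poly (n - 2) :: 'a::comm_ring_1 poly)"
proof (cases "n > 1")
  case True
  then show ?thesis by (subst fib_poly.simps) simp
next
  case False
  have "(fib_poly (n - 2) :: 'a poly) = fib_poly (n - 2 + 2) - [:0, 1:] * fib_poly (n - 2 + 1)"
    using False by (subst fib_poly.simps) simp
  then show ?thesis by (simp add: algebra_simps)
qed

end

theory Submission
  imports Defs
begin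

text \<open>
  Running through one period, the numerators \<open>P\<^sub>n = p\<^bsub>nd+r-1\<^esub>\<close> satisfy
  \<open>P\<^bsub>n+1\<^esub> = F\<^sub>d \<beta>\<^sub>1 (n + \<sigma>) P\<^sub>n + (-1)\<^bsup>d-1\<^esup> P\<^bsub>n-1\<^esub>\<close>, and likewise for the denominators.
  So \<open>y\<^sub>n = P\<^sub>n / (F\<^sub>d \<beta>\<^sub>1)\<^sup>n\<close> solves \<open>y\<^bsub>n+1\<^esub> = (n + \<sigma>) y\<^sub>n + \<rho> y\<^bsub>n-1\<^esub>\<close>. The first
  sum of the theorem is the solution with initial values \<open>1, \<sigma>\<close>; the second one, divided by \<open>\<rho>\<close>,
  is the first sum shifted by \<open>n \<mapsto> n - 1\<close>, \<open>\<sigma> \<mapsto> \<sigma> + 1\<close> and is the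
  solution with initial values \<open>0, 1\<close>. It remains to compare initial values, which is d'Ocagne's
  identity.
\<close>

section \<open>The sums of the formulas and their three-term recurrence\<close>

definition hsum :: "real \<Rightarrow> real \<Rightarrow> nat \<Rightarrow> real" where
  "hsum \<sigma> \<rho> n = (\<Sum>k = 0..n div 2. fact (n - k) / fact k
     * ((of_nat n + \<sigma> - 1 - of_nat k) gchoose (n - 2 * k)) * \<rho> ^ k)"

text \<open>Padding with zeros beyond \<open>n div 2\<close> gives sums for different
  \<open>n\<close> a common range, so that the recurrence can be checked coefficient by coefficient
  in \<rho>.\<close>

definition hcoeff :: "real \<Rightarrow> nat \<Rightarrow> nat \<Rightarrow> real" where
  "hcoeff \<sigma> n k = (if 2 * k \<le> n then fact (n - k) / fact k
     * ((of_nat n + \<sigma> - 1 - of_nat k) gchoose (n - 2 * k)) else 0)"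

lemma hsum_eq_hcoeff:
  assumes "n \<le> N"
  shows "hsum \<sigma> \<rho> n = (\<Sum>k\<le>N. hcoeff \<sigma> n k * \<rho> ^ k)"
proof -
  have "(\<Sum>k\<le>N. hcoeff \<sigma> n k * \<rho> ^ k) = (\<Sum>k = 0..n div 2. hcoeff \<sigma> n k * \<rho> ^ k)"
    using assms by (intro sum.mono_neutral_right) (auto simp: hcoeff_def)
  also have "\<dots> = hsum \<sigma> \<rho> n"
    unfolding hsum_def by (intro sum.cong) (auto simp: hcoeff_def)
  finally show ?thesis by simp
qed

text \<open>Pascal's rule times \<open>t\<close>, plus the vanishing quantity
  \<open>(x - m) * (x gchoose m) - Suc m * (x gchoose Suc m)\<close>. The weight \<open>t\<close>
  will be the top factor of a factorial.\<close>

lemma gbinomial_weighted_rec: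
  fixes x t :: real
  shows "t * ((x + 1) gchoose Suc m) =
         (t + x - real m) * (x gchoose m) + (t - real (Suc m)) * (x gchoose Suc m)"
proof -
  have "real (Suc m) * (x gchoose Suc m) = (x - real m) * (x gchoose m)"
    using gbinomial_absorb_comp[of x m] gbinomial_absorption[of m x] by simp
  moreover have "(x + 1) gchoose Suc m = (x gchoose m) + (x gchoose Suc m)"
    by (rule gbinomial_Suc_Suc)
  ultimately show ?thesis by (simp add: algebra_simps)
qed

text \<open>For \<open>k = 0\<close> the coefficient is the rising factorial of \<sigma> of length
  \<open>n\<close>, which gains one factor per step.\<close>

lemma hcoeff_rec_0: "hcoeff \<sigma> (Suc n) 0 = (real n + \<sigma>) * hcoeff \<sigma> n 0"
proof -
  have "real (Suc n) * ((real n + \<sigma>) gchoose Suc n) = (real n + \<sigma>) * ((real n + \<sigma> - 1) gchoose n)"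
    using gbinomial_absorption[of n "real n + \<sigma>"] by simp
  moreover have "hcoeff \<sigma> (Suc n) 0 = fact n * (real (Suc n) * ((real n + \<sigma>) gchoose Suc n))"
    by (simp add: hcoeff_def algebra_simps)
  ultimately show ?thesis by (simp add: hcoeff_def)
qed

lemma hcoeff_rec_Suc:
  "hcoeff \<sigma> (Suc (Suc n)) (Suc k) =
     (real (Suc n) + \<sigma>) * hcoeff \<sigma> (Suc n) (Suc k) + hcoeff \<sigma> n k"
proof -
  \<comment> \<open>In the first case all three coefficients are padding; in the second the identity
    reads 1 = 0 + 1.\<close>
  consider "n < 2 * k" | "n = 2 * k" | m where "n = Suc m + 2 * k"
    by (metis add.commute less_imp_Suc_add linorder_neqE_nat add_Suc_right)
  then show ?thesis
  proof cases
    case 1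
    then show ?thesis by (simp add: hcoeff_def)
  next
    case 2
    then show ?thesis by (simp add: hcoeff_def)
  next
    case (3 m)
    \<comment> \<open>The upper argument shared by both binomials on the right-hand side; on the
      left it is \<open>x + 1\<close>.\<close>
    define x where "x = real m + real k + \<sigma>"
    have "hcoeff \<sigma> (Suc (Suc n)) (Suc k) =
        fact (Suc (Suc m + k)) / fact (Suc k) * ((x + 1) gchoose Suc m)"
      by (simp add: hcoeff_def 3 x_def algebra_simps)
    also have "\<dots> = fact (Suc m + k) / fact (Suc k) *
        (real (Suc (Suc m + k)) * ((x + 1) gchoose Suc m))"
      by (simp only: fact_Suc[of "Suc m + k"]) simp
    \<comment> \<open>For \<open>t = m + k + 2\<close> the two weights are
      \<open>t + x - m = Suc n + \<sigma>\<close> and \<open>t - Suc m = Suc k\<close>; the latter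
      cancels a factor of \<open>fact (Suc k)\<close>.\<close>
    also have "real (Suc (Suc m + k)) * ((x + 1) gchoose Suc m) =
        (real (Suc n) + \<sigma>) * (x gchoose m) + real (Suc k) * (x gchoose Suc m)"
      using gbinomial_weighted_rec[of "real (Suc (Suc m + k))" x m]
      by (simp add: 3 x_def algebra_simps)
    also have "fact (Suc m + k) / fact (Suc k) * \<dots> =
        (real (Suc n) + \<sigma>) * (fact (Suc m + k) / fact (Suc k) * (x gchoose m)) +
        fact (Suc m + k) / fact k * (x gchoose Suc m)"
      by (simp add: divide_simps) (simp add: algebra_simps)
    also have "fact (Suc m + k) / fact (Suc k) * (x gchoose m) = hcoeff \<sigma> (Suc n) (Suc k)"
      by (simp add: hcoeff_def 3 x_def algebra_simps)
    also have "fact (Suc m + k) / fact k * (x gchoose Suc m) = hcoeff \<sigma> n k"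
      by (simp add: hcoeff_def 3 x_def algebra_simps)
    finally show ?thesis .
  qed
qed

lemma hsum_rec:
  "hsum \<sigma> \<rho> (Suc (Suc n)) = (real (Suc n) + \<sigma>) * hsum \<sigma> \<rho> (Suc n) + \<rho> * hsum \<sigma> \<rho> n"
proof -
  \<comment> \<open>The constant term is split off because the recurrence for the others lowers
    \<open>k\<close> in its last summand; that shift produces the factor \<rho>.\<close>
  have "hsum \<sigma> \<rho> (Suc (Suc n)) = hcoeff \<sigma> (Suc (Suc n)) 0 +
      (\<Sum>k\<le>Suc n. hcoeff \<sigma> (Suc (Suc n)) (Suc k) * \<rho> ^ Suc k)"
    by (simp only: hsum_eq_hcoeff[OF order_refl] sum.atMost_Suc_shift power_0 mult_1_right)
  also have "\<dots> = (real (Suc n) + \<sigma>) * (hcoeff \<sigma> (Suc n) 0 +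
      (\<Sum>k\<le>Suc n. hcoeff \<sigma> (Suc n) (Suc k) * \<rho> ^ Suc k)) +
      \<rho> * (\<Sum>k\<le>Suc n. hcoeff \<sigma> n k * \<rho> ^ k)"
    unfolding hcoeff_rec_0[of \<sigma> "Suc n"] hcoeff_rec_Suc distrib_left sum_distrib_left add.assoc
      sum.distrib[symmetric]
    by (simp add: algebra_simps)
  also have "hcoeff \<sigma> (Suc n) 0 + (\<Sum>k\<le>Suc n. hcoeff \<sigma> (Suc n) (Suc k) * \<rho> ^ Suc k) =
      hsum \<sigma> \<rho> (Suc n)"
    using hsum_eq_hcoeff[of "Suc n" "Suc (Suc n)" \<sigma> \<rho>]
    by (simp only: sum.atMost_Suc_shift power_0 mult_1_right)
  also have "(\<Sum>k\<le>Suc n. hcoeff \<sigma> n k * \<rho> ^ k) = hsum \<sigma> \<rho> n"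
    by (simp add: hsum_eq_hcoeff[of n "Suc n"])
  finally show ?thesis .
qed

lemma hsum_0 [simp]: "hsum \<sigma> \<rho> 0 = 1"
  and hsum_1 [simp]: "hsum \<sigma> \<rho> (Suc 0) = \<sigma>"
  by (simp_all add: hsum_def)

lemma second_sum_eq_hsum:
  "(\<Sum>k | int k \<le> (int n - 1) div 2. fact (n - k - 1) / fact k
      * ((of_nat n + \<sigma> - 1 - of_nat k) gchoose (n - 2 * k - 1)) * \<rho> ^ (k + 1)) =
   \<rho> * (if n = 0 then 0 else hsum (\<sigma> + 1) \<rho> (n - 1))"
proof (cases n)
  \<comment> \<open>Here \<open>(int n - 1) div 2\<close> is -1, so no \<open>k\<close> qualifies
    and the sum is empty.\<close>
  case 0
  then show ?thesis by simp
next
  case (Suc m)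
  have "{k. int k \<le> (int n - 1) div 2} = {0..m div 2}"
    using Suc by auto
  moreover have "real n + \<sigma> - 1 = real m + (\<sigma> + 1) - 1" "n - 1 = m"
    and "n - k - 1 = m - k" "n - 2 * k - 1 = m - 2 * k" for k
    using Suc by auto
  ultimately show ?thesis
    using Suc by (simp only: hsum_def) (simp add: sum_distrib_left mult_ac)
qed

lemma linear_rec_solution:
  fixes y :: "nat \<Rightarrow> real"
  assumes rec: "\<And>n. y (Suc (Suc n)) = (real (Suc n) + \<sigma>) * y (Suc n) + \<rho> * y n"
  shows "y n = y 0 * hsum \<sigma> \<rho> n +
    (y 1 - \<sigma> * y 0) * (if n = 0 then 0 else hsum (\<sigma> + 1) \<rho> (n - 1))"
proof -
  \<comment> \<open>\<open>B\<close> starts with 0, 1. Since \<open>hsum\<close> starts with 1,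
    \<sigma>, matching \<open>y 1\<close> leaves the coefficient \<open>y 1 - \<sigma> * y 0\<close>
    for \<open>B\<close>.\<close>
  define B where "B n = (if n = 0 then 0 else hsum (\<sigma> + 1) \<rho> (n - 1))" for n
  have B_rec: "B (Suc (Suc n)) = (real (Suc n) + \<sigma>) * B (Suc n) + \<rho> * B n" for n
    by (cases n) (simp_all add: B_def hsum_rec algebra_simps)
  have "y n = y 0 * hsum \<sigma> \<rho> n + (y 1 - \<sigma> * y 0) * B n"
  proof (induction n rule: induct_nat_012)
    case (ge2 n)
    show ?case
      unfolding rec[of n] hsum_rec B_rec ge2.IH by (simp add: algebra_simps)
  qed (simp_all add: B_def algebra_simps)
  then show ?thesis by (simp only: B_def)
qed

section \<open>Identities for values of Fibonacci and Lucas polynomials\<close>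

abbreviation (input) fibv :: "real \<Rightarrow> int \<Rightarrow> real" where
  "fibv x m \<equiv> poly (fib_poly m) x"

lemma fibv_0 [simp]: "fibv x 0 = 0"
  and fibv_1 [simp]: "fibv x 1 = 1"
  by (simp_all add: fib_poly_0_1)

lemma fibv_rec: "fibv x m = x * fibv x (m - 1) + fibv x (m - 2)"
  by (subst fib_poly_rec) simp

lemma fibv_neg1 [simp]: "fibv x (- 1) = 1"
  using fibv_rec[of 1 x] by simp

lemma fibv_pos:
  assumes "x > 0"
  shows "fibv x (int (Suc n)) > 0"
proof (induction n rule: induct_nat_012)
  case 0
  then show ?case by simp
next
  case 1
  then show ?case using assms fibv_rec[of 2 x] by simp
next
  case (ge2 n)
  have "fibv x (int (Suc (Suc (Suc n)))) = x * fibv x (int (Suc (Suc n))) + fibv x (int (Suc n))"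
    by (subst fibv_rec) simp
  then show ?case using ge2 assms by (simp add: add_pos_pos)
qed

text \<open>The left side is a 2 by 2 determinant; expanding the larger index in each product shows
  that lowering \<open>m\<close> and \<open>r\<close> together flips its sign. The index
  \<open>m\<close> is an integer because \<open>m - r - 1\<close> may be negative.\<close>

lemma fibv_dOcagne:
  "fibv x m * fibv x (int r) - fibv x (m - 1) * fibv x (int r + 1) =
   (- 1) ^ Suc r * fibv x (m - int r - 1)"
proof (induction r arbitrary: m)
  case 0
  then show ?case by simp
next
  case (Suc r)
  have "fibv x (int (Suc r) + 1) = x * fibv x (int r + 1) + fibv x (int r)"
    by (subst fibv_rec) (simp add: algebra_simps)
  moreover have "fibv x m = x * fibv x (m - 1) + fibv x (m - 2)"
    by (rule fibv_rec)
  ultimately have "fibv x m * fibv x (int (Suc r)) - fibv x (m - 1) * fibv x (int (Suc r) + 1) =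
      - (fibv x (m - 1) * fibv x (int r) - fibv x (m - 1 - 1) * fibv x (int r + 1))"
    by (simp add: algebra_simps)
  also have "\<dots> = (- 1) ^ Suc (Suc r) * fibv x (m - int (Suc r) - 1)"
    by (subst Suc.IH) (simp add: algebra_simps)
  finally show ?case .
qed

text \<open>The same identity with \<open>r\<close> lowered by one, valid also for
  \<open>r = 0\<close>, where F_{-1} occurs. It comes from \<open>m + 1\<close> by cancelling the
  multiples of \<open>x\<close>.\<close>

lemma fibv_dOcagne':
  "fibv x m * fibv x (int r - 1) - fibv x (m - 1) * fibv x (int r) =
   (- 1) ^ r * fibv x (m - int r)"
proof -
  have "fibv x (int r + 1) = x * fibv x (int r) + fibv x (int r - 1)"
    by (subst fibv_rec) simp
  moreover have "fibv x (m + 1) = x * fibv x m + fibv x (m - 1)"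
    by (subst fibv_rec) simp
  ultimately show ?thesis
    using fibv_dOcagne[of "m + 1" x r] by (simp add: algebra_simps)
qed

text \<open>The case \<open>m = r = d\<close> of d'Ocagne's identity, where the right side contains
  F_{-1} = 1.\<close>

lemma fibv_Cassini:
  "fibv x (int d) * fibv x (int d - 2) - fibv x (int d - 1) ^ 2 = (- 1) ^ Suc d"
proof -
  have "fibv x (int d + 1) = x * fibv x (int d) + fibv x (int d - 1)"
    by (subst fibv_rec) simp
  moreover have "fibv x (int d) = x * fibv x (int d - 1) + fibv x (int d - 2)"
    by (rule fibv_rec)
  ultimately show ?thesis
    using fibv_dOcagne[of "int d" x d] by (simp add: algebra_simps power2_eq_square)
qed

text \<open>This is L_d = F_{d+1} + F_{d-1} with F_{d+1} expanded. In this form the \<alpha> in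
  \<sigma> cancels: F_d \<beta>_1 \<sigma> = \<beta>_0 F_d + 2 F_{d-1}.\<close>

lemma lucas_eq_fibv: "poly (lucas_poly d) x = x * fibv x (int d) + 2 * fibv x (int d - 1)"
proof (induction d rule: induct_nat_012)
  case (ge2 n)
  have "fibv x (int (Suc (Suc n))) = x * fibv x (int n + 1) + fibv x (int n)"
    by (subst fibv_rec) (simp add: algebra_simps)
  moreover have "fibv x (int n + 1) = x * fibv x (int n) + fibv x (int n - 1)"
    by (subst fibv_rec) simp
  ultimately show ?case using ge2 by (simp add: algebra_simps)
qed simp_all

section \<open>Passing through blocks of the continued fraction\<close>

text \<open>Equal partial quotients act by powers of one 2 by 2 matrix with Fibonacci entries.
  Getting from \<open>Y m\<close>, \<open>Y (Suc m)\<close> to \<open>Y (m + j)\<close> uses only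
  \<open>j - 1\<close> quotients, whence \<open>Suc i < j\<close>.\<close>

lemma constant_block:
  fixes Y a :: "nat \<Rightarrow> real"
  assumes rec: "\<And>k. Y (Suc (Suc k)) = a k * Y (Suc k) + Y k"
    and "\<And>i. Suc i < j \<Longrightarrow> a (m + i) = x"
  shows "Y (m + j) = fibv x (int j) * Y (Suc m) + fibv x (int j - 1) * Y m"
  using assms(2)
proof (induction j rule: induct_nat_012)
  case (ge2 j)
  have "fibv x (int (Suc (Suc j))) = x * fibv x (int j + 1) + fibv x (int j)"
    by (subst fibv_rec) (simp add: algebra_simps)
  moreover have "fibv x (int j + 1) = x * fibv x (int j) + fibv x (int j - 1)"
    by (subst fibv_rec) simp
  moreover have "a (m + j) = x" using ge2.prems by simp
  moreover have "Y (m + j) = fibv x (int j) * Y (Suc m) + fibv x (int j - 1) * Y m"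
    using ge2.IH(1) ge2.prems by simp
  moreover have "Y (m + Suc j) = fibv x (int (Suc j)) * Y (Suc m) + fibv x (int (Suc j) - 1) * Y m"
    using ge2.IH(2) ge2.prems by simp
  ultimately show ?case by (simp add: rec algebra_simps)
qed simp_all

text \<open>
  The index is shifted by two: \<open>Y m\<close> stands for \<open>p\<^bsub>m-2\<^esub>\<close> or \<open>q\<^bsub>m-2\<^esub>\<close>, with
  \<open>p\<^bsub>-2\<^esub> = 0\<close> and \<open>q\<^bsub>-2\<^esub> = 1\<close>, so that the recurrence holds from the start.
\<close>
lemma xi_recurrence_solution:
  fixes \<alpha> \<beta>\<^sub>0 \<beta>\<^sub>1 :: int and d r n :: nat and Y :: "nat \<Rightarrow> real"
  defines "x \<equiv> real_of_int \<alpha>"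
  defines "\<sigma> \<equiv> of_int (\<beta>\<^sub>0 - \<alpha>) / of_int \<beta>\<^sub>1 + poly (lucas_poly d) x / (of_int \<beta>\<^sub>1 * fibv x (int d))"
    and "\<rho> \<equiv> (-1) ^ (d - 1) / ((of_int \<beta>\<^sub>1)\<^sup>2 * (fibv x (int d))\<^sup>2)"
  assumes \<alpha>: "\<alpha> > 0" and \<beta>\<^sub>1: "\<beta>\<^sub>1 > 0" and d: "d > 0"
    and rec: "\<And>k. Y (Suc (Suc k)) = of_int (xi \<alpha> \<beta>\<^sub>0 \<beta>\<^sub>1 d r k) * Y (Suc k) + Y k"
  shows "Y (Suc (n * d + r)) / (fibv x (int d) ^ n * of_int \<beta>\<^sub>1 ^ n) =
    (fibv x (int r + 1) * Y 1 + fibv x (int r) * Y 0) * hsum \<sigma> \<rho> n +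
    ((fibv x (int d) * fibv x (int r) - fibv x (int d - 1) * fibv x (int r + 1)) * Y 1 +
     (fibv x (int d) * fibv x (int r - 1) - fibv x (int d - 1) * fibv x (int r)) * Y 0) /
      (fibv x (int d) * of_int \<beta>\<^sub>1) * (if n = 0 then 0 else hsum (\<sigma> + 1) \<rho> (n - 1))"
proof -
  let ?F = "fibv x"
  define b where "b = real_of_int \<beta>\<^sub>1"
  define D where "D = ?F (int d) * b"
  define P where "P n = Y (Suc (n * d + r))" for n
  obtain d' where d': "d = Suc d'" using d by (cases d) auto
  have b: "b > 0" using \<beta>\<^sub>1 by (simp add: b_def)
  have Fd: "?F (int d) > 0" using fibv_pos[of x d'] \<alpha> by (simp add: d' x_def)
  have D: "D > 0" using b Fd by (simp add: D_def)
  have D_sigma: "D * \<sigma> = (of_int \<beta>\<^sub>0 - x) * ?F (int d) + poly (lucas_poly d) x"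
    using b Fd by (simp add: D_def \<sigma>_def b_def[symmetric] x_def[symmetric] field_simps)
  have D_rho: "D ^ 2 * \<rho> = (- 1) ^ Suc d"
    using b Fd by (simp add: D_def \<rho>_def b_def[symmetric] d' power_mult_distrib)
  have head: "of_int (xi \<alpha> \<beta>\<^sub>0 \<beta>\<^sub>1 d r (k * d + r)) = of_int \<beta>\<^sub>0 + b * real k" for k
    using xi_special[OF d, of \<alpha> \<beta>\<^sub>0 \<beta>\<^sub>1 r k] by (simp add: add.commute b_def)
  have tail: "of_int (xi \<alpha> \<beta>\<^sub>0 \<beta>\<^sub>1 d r (Suc (k * d + r) + i)) = x" if "Suc i < d" for k i
  proof -
    have "\<not> d dvd (k * d + Suc i)"
      using nat_dvd_not_less[of "Suc i" d] that by (metis dvd_add_right_iff dvd_triv_right zero_less_Suc)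
    then show ?thesis by (simp add: xi_def x_def add.commute add.left_commute)
  qed
  have init: "of_int (xi \<alpha> \<beta>\<^sub>0 \<beta>\<^sub>1 d r i) = x" if "i < r" for i
    using that by (simp add: xi_def x_def)
  note const_block = constant_block[of Y "\<lambda>k. of_int (xi \<alpha> \<beta>\<^sub>0 \<beta>\<^sub>1 d r k)", OF rec]
  \<comment> \<open>The run starts just behind the special quotient at \<open>k * d + r\<close> and
    has \<open>d - 1\<close> entries equal to \<alpha>.\<close>
  have block: "Y (Suc (k * d + r) + j) = ?F (int j) * Y (Suc (Suc (k * d + r))) + ?F (int j - 1) * P k"
    if "j \<le> d" for k j
    unfolding P_def using that tail by (intro const_block) auto
  have step: "P (Suc k) = (?F (int d) * (of_int \<beta>\<^sub>0 + b * real k) + ?F (int d - 1)) * P k +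
      ?F (int d) * Y (k * d + r)" for k
  proof -
    have "P (Suc k) = Y (Suc (k * d + r) + d)" by (simp add: P_def add.commute add.left_commute)
    also have "\<dots> = ?F (int d) * Y (Suc (Suc (k * d + r))) + ?F (int d - 1) * P k"
      by (rule block) simp
    also have "Y (Suc (Suc (k * d + r))) = (of_int \<beta>\<^sub>0 + b * real k) * P k + Y (k * d + r)"
      by (simp add: rec head P_def)
    finally show ?thesis by (simp add: distrib_left distrib_right mult_ac)
  qed
  \<comment> \<open>\<open>P (Suc k)\<close> and its predecessor are combinations of the same pair
    \<open>?u\<close>, \<open>P k\<close>; eliminating \<open>?u\<close> leaves Cassini's
    determinant.\<close>
  have prev: "?F (int d) * Y (Suc k * d + r) = ?F (int d - 1) * P (Suc k) + (- 1) ^ Suc d * P k" for k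
  proof -
    let ?u = "Y (Suc (Suc (k * d + r)))"
    have "P (Suc k) = Y (Suc (k * d + r) + d)" by (simp add: P_def add.commute add.left_commute)
    also have "\<dots> = ?F (int d) * ?u + ?F (int d - 1) * P k" by (rule block) simp
    finally have 1: "P (Suc k) = \<dots>" .
    have "Y (Suc k * d + r) = Y (Suc (k * d + r) + d')"
      by (simp add: d' add.commute add.left_commute)
    also have "\<dots> = ?F (int d') * ?u + ?F (int d' - 1) * P k" by (rule block) (simp add: d')
    finally have 2: "Y (Suc k * d + r) = ?F (int d - 1) * ?u + ?F (int d - 2) * P k"
      by (simp add: d')
    show ?thesis
      unfolding 1 2 fibv_Cassini[symmetric, of d x] by (simp add: algebra_simps power2_eq_square)
  qed
  \<comment> \<open>\<open>step\<close> and \<open>prev\<close> each contribute one F_{d-1},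
    together the 2 F_{d-1} contained in \<open>D * \<sigma>\<close>.\<close>
  have P_rec: "P (Suc (Suc k)) = D * (real (Suc k) + \<sigma>) * P (Suc k) + D ^ 2 * \<rho> * P k" for k
    using D_sigma
    unfolding step[of "Suc k"] prev D_rho distrib_left lucas_eq_fibv
    by (simp add: D_def algebra_simps)
  define y where "y n = P n / D ^ n" for n
  have y_rec: "y (Suc (Suc k)) = (real (Suc k) + \<sigma>) * y (Suc k) + \<rho> * y k" for k
    using D unfolding y_def P_rec by (simp add: field_simps power2_eq_square)
  \<comment> \<open>The leading block: \<open>Y r\<close> uses \<open>r - 1\<close> of its
    quotients, \<open>y 0\<close> all \<open>r\<close>.\<close>
  have Y_r: "Y r = ?F (int r) * Y 1 + ?F (int r - 1) * Y 0"
    using const_block[of r 0 x] init by simp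
  have y0: "y 0 = ?F (int r + 1) * Y 1 + ?F (int r) * Y 0"
    using const_block[of "Suc r" 0 x] init by (simp add: y_def P_def add.commute)
  have "D * (y 1 - \<sigma> * y 0) = P 1 - D * \<sigma> * P 0"
    using D by (simp add: y_def field_simps)
  \<comment> \<open>In \<open>P 1\<close> the coefficient of \<open>P 0\<close> is \<beta>_0 F_d +
    F_{d-1}, which is \<open>D * \<sigma>\<close> minus F_{d-1}.\<close>
  also have "\<dots> = ?F (int d) * Y r - ?F (int d - 1) * y 0"
    using step[of 0] unfolding D_sigma lucas_eq_fibv by (simp add: y_def algebra_simps)
  also have "\<dots> = (?F (int d) * ?F (int r) - ?F (int d - 1) * ?F (int r + 1)) * Y 1 +
      (?F (int d) * ?F (int r - 1) - ?F (int d - 1) * ?F (int r)) * Y 0" (is "_ = ?E")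
    unfolding y0 Y_r by (simp add: algebra_simps)
  finally have y1: "y 1 - \<sigma> * y 0 = ?E / D"
    using D by (simp add: field_simps)
  have "y n = y 0 * hsum \<sigma> \<rho> n +
      (y 1 - \<sigma> * y 0) * (if n = 0 then 0 else hsum (\<sigma> + 1) \<rho> (n - 1))"
    by (rule linear_rec_solution[of y \<sigma> \<rho>, OF y_rec])
  then show ?thesis
    unfolding y1 unfolding y0 by (simp only: y_def P_def D_def b_def power_mult_distrib)
qed

section \<open>Convergents as quotients of numerators and denominators\<close>

lemma cfrac_num_simps [simp]:
  "cfrac_num a (- 1) = 1" "cfrac_num a 0 = a 0"
  "cfrac_num a (int (Suc m)) = a (Suc m) * cfrac_num a (int m) + cfrac_num a (int m - 1)"
  by (subst cfrac_num.simps; simp add: nat_add_distrib)+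

lemma cfrac_den_simps [simp]:
  "cfrac_den a (- 1) = 0" "cfrac_den a 0 = 1"
  "cfrac_den a (int (Suc m)) = a (Suc m) * cfrac_den a (int m) + cfrac_den a (int m - 1)"
  by (subst cfrac_den.simps; simp add: nat_add_distrib)+

lemma cfrac_den_bounds:
  assumes "\<And>i. a i > 0"
  shows "cfrac_den a (int m) > 0 \<and> cfrac_den a (int m - 1) \<ge> 0"
proof (induction m)
  case (Suc m)
  have "int (Suc m) - 1 = int m" by simp
  then show ?case
    unfolding cfrac_den_simps using Suc assms[of "Suc m"] by (simp add: add_pos_nonneg)
qed simp

text \<open>\<open>cfrac_value\<close> unfolds from the front, numerators and denominators grow at
  the end; merging the last two entries reconciles them.\<close>

lemma cfrac_value_merge:
  "cfrac_value (xs @ [y, x]) = cfrac_value (xs @ [y + 1 / x])"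
  by (induction xs rule: cfrac_value.induct) simp_all

text \<open>The last entry is an arbitrary positive real because merging turns it into
  \<open>a (Suc m) + 1 / x\<close>, which need not be an integer.\<close>

lemma cfrac_value_last:
  assumes "\<And>i. a i > 0" and "x > 0"
  shows "cfrac_value (map (\<lambda>i. of_int (a i)) [0..<Suc m] @ [x]) =
    (x * of_int (cfrac_num a (int m)) + of_int (cfrac_num a (int m - 1))) /
    (x * of_int (cfrac_den a (int m)) + of_int (cfrac_den a (int m - 1)))"
  using assms(2)
proof (induction m arbitrary: x)
  case 0
  then show ?case by (simp add: field_simps)
next
  case (Suc m)
  let ?z = "real_of_int (a (Suc m)) + 1 / x"
  have z: "?z > 0" using assms(1)[of "Suc m"] Suc.prems by (simp add: add_pos_pos)
  have "cfrac_value (map (\<lambda>i. of_int (a i)) [0..<Suc (Suc m)] @ [x]) =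
      cfrac_value (map (\<lambda>i. of_int (a i)) [0..<Suc m] @ [?z])"
    using cfrac_value_merge[of "map (\<lambda>i. of_int (a i)) [0..<Suc m]" "of_int (a (Suc m))" x] by simp
  also have "\<dots> = (?z * of_int (cfrac_num a (int m)) + of_int (cfrac_num a (int m - 1))) /
      (?z * of_int (cfrac_den a (int m)) + of_int (cfrac_den a (int m - 1)))"
    by (rule Suc.IH[OF z])
  \<comment> \<open>Expanding by \<open>x\<close> clears the \<open>1 / x\<close> in
    \<open>?z\<close> and exposes the recurrence at \<open>Suc m\<close>.\<close>
  also have "\<dots> = (x * (?z * of_int (cfrac_num a (int m)) + of_int (cfrac_num a (int m - 1)))) /
      (x * (?z * of_int (cfrac_den a (int m)) + of_int (cfrac_den a (int m - 1))))"
    using Suc.prems by simp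
  also have "x * (?z * of_int (cfrac_num a (int m)) + of_int (cfrac_num a (int m - 1))) =
      x * of_int (cfrac_num a (int (Suc m))) + of_int (cfrac_num a (int (Suc m) - 1))"
    unfolding cfrac_num_simps using Suc.prems by (simp add: field_simps)
  also have "x * (?z * of_int (cfrac_den a (int m)) + of_int (cfrac_den a (int m - 1))) =
      x * of_int (cfrac_den a (int (Suc m))) + of_int (cfrac_den a (int (Suc m) - 1))"
    unfolding cfrac_den_simps using Suc.prems by (simp add: field_simps)
  finally show ?case .
qed

lemma convergent_of_eq:
  assumes "\<And>i. a i > 0"
  shows "convergent_of a m = of_int (cfrac_num a (int m)) / of_int (cfrac_den a (int m))"
proof (cases m)
  case 0
  then show ?thesis by (simp add: convergent_of_def)
next
  case (Suc k)
  have "convergent_of a m = cfrac_value (map (\<lambda>i. of_int (a i)) [0..<Suc k] @ [of_int (a m)])"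
    by (simp add: convergent_of_def Suc)
  also have "\<dots> = of_int (cfrac_num a (int m)) / of_int (cfrac_den a (int m))"
    using assms[of m] unfolding Suc cfrac_num_simps cfrac_den_simps
    by (subst cfrac_value_last[OF assms]) (simp_all add: Suc)
  finally show ?thesis .
qed

section \<open>Specialisation to \<open>p\<close> and \<open>q\<close>\<close>

theorem theorem2p2:
  fixes \<alpha> \<beta>\<^sub>0 \<beta>\<^sub>1 :: int and d r n :: nat
    and p q :: "int \<Rightarrow> int" and F :: "int \<Rightarrow> real" and L :: "nat \<Rightarrow> real" and \<sigma> \<rho> :: real
  assumes "\<alpha> > 0" and "\<beta>\<^sub>0 > 0" and "\<beta>\<^sub>1 > 0" and "d > 0"
    and p: "p = cfrac_num (xi \<alpha> \<beta>\<^sub>0 \<beta>\<^sub>1 d r)"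
    and q: "q = cfrac_den (xi \<alpha> \<beta>\<^sub>0 \<beta>\<^sub>1 d r)"
    and F: "F = (\<lambda>m. poly (fib_poly m) (of_int \<alpha>))"
    and L: "L = (\<lambda>m. poly (lucas_poly m) (of_int \<alpha>))"
    and \<sigma>: "\<sigma> = of_int (\<beta>\<^sub>0 - \<alpha>) / of_int \<beta>\<^sub>1 + L d / (of_int \<beta>\<^sub>1 * F (int d))"
    and \<rho>: "\<rho> = (-1) ^ (d - 1) / ((of_int \<beta>\<^sub>1)\<^sup>2 * (F (int d))\<^sup>2)"
  shows "(n * d + r \<ge> 1 \<longrightarrow>
            convergent_of (xi \<alpha> \<beta>\<^sub>0 \<beta>\<^sub>1 d r) (n * d + r - 1) =
              of_int (p (int n * int d + int r - 1)) / of_int (q (int n * int d + int r - 1))) \<and>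
         of_int (p (int n * int d + int r - 1)) / (F (int d) ^ n * of_int \<beta>\<^sub>1 ^ n) =
           F (int r + 1) *
             (\<Sum>k = 0..n div 2. fact (n - k) / fact k
                * ((of_nat n + \<sigma> - 1 - of_nat k) gchoose (n - 2 * k)) * \<rho> ^ k)
           + (-1) powi (int d - int r) * F (int d - int r - 1) * F (int d) * of_int \<beta>\<^sub>1 *
             (\<Sum>k | int k \<le> (int n - 1) div 2. fact (n - k - 1) / fact k
                * ((of_nat n + \<sigma> - 1 - of_nat k) gchoose (n - 2 * k - 1)) * \<rho> ^ (k + 1)) \<and>
         of_int (q (int n * int d + int r - 1)) / (F (int d) ^ n * of_int \<beta>\<^sub>1 ^ n) =
           F (int r) *
             (\<Sum>k = 0..n div 2. fact (n - k) / fact k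
                * ((of_nat n + \<sigma> - 1 - of_nat k) gchoose (n - 2 * k)) * \<rho> ^ k)
           + (-1) powi (int d + 1 - int r) * F (int d - int r) * F (int d) * of_int \<beta>\<^sub>1 *
             (\<Sum>k | int k \<le> (int n - 1) div 2. fact (n - k - 1) / fact k
                * ((of_nat n + \<sigma> - 1 - of_nat k) gchoose (n - 2 * k - 1)) * \<rho> ^ (k + 1))"
proof -
  let ?a = "xi \<alpha> \<beta>\<^sub>0 \<beta>\<^sub>1 d r"
  define x where "x = real_of_int \<alpha>"
  let ?B = "if n = 0 then 0 else hsum (\<sigma> + 1) \<rho> (n - 1)"
  let ?D = "F (int d) * of_int \<beta>\<^sub>1"
  let ?y = "\<lambda>z. z / (F (int d) ^ n * of_int \<beta>\<^sub>1 ^ n)"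
  have F': "F = fibv x" and L': "L = (\<lambda>m. poly (lucas_poly m) x)"
    by (simp_all add: F L x_def)
  have sr: "\<sigma> = of_int (\<beta>\<^sub>0 - \<alpha>) / of_int \<beta>\<^sub>1 + poly (lucas_poly d) x / (of_int \<beta>\<^sub>1 * fibv x (int d))"
    "\<rho> = (-1) ^ (d - 1) / ((of_int \<beta>\<^sub>1)\<^sup>2 * (fibv x (int d))\<^sup>2)"
    by (simp_all add: \<sigma> \<rho> F' L')
  obtain d' where d': "d = Suc d'" using \<open>d > 0\<close> by (cases d) auto
  have Fd: "F (int d) > 0" using fibv_pos[of x d'] \<open>\<alpha> > 0\<close> by (simp add: F' d' x_def)
  have "?D \<noteq> 0" using Fd \<open>\<beta>\<^sub>1 > 0\<close> by simp
  have D_rho: "?D * ?D * \<rho> = (- 1) ^ d'"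
    using Fd \<open>\<beta>\<^sub>1 > 0\<close> by (simp add: \<rho> d' power2_eq_square)
  \<comment> \<open>The exponents agree modulo 2, as (d - r) + (d - 1) is congruent to r + 1.
    Dividing by \<open>?D\<close> thus becomes multiplying by \<open>?D * \<rho>\<close>, the shape
    of the second sum.\<close>
  have sign_p: "(- 1) ^ Suc r = (- 1) powi (int d - int r) * (?D * ?D * \<rho>)"
    unfolding D_rho by (cases "even r") (simp_all add: d' power_int_diff power_int_add flip: power_add)
  have sign_q: "(- 1) ^ r = (- 1) powi (int d + 1 - int r) * (?D * ?D * \<rho>)"
    unfolding D_rho by (cases "even r") (simp_all add: d' power_int_diff power_int_add flip: power_add)
  have pos: "?a i > 0" for i
    using \<open>\<alpha> > 0\<close> \<open>\<beta>\<^sub>0 > 0\<close> \<open>\<beta>\<^sub>1 > 0\<close> by (simp add: xi_def add_pos_nonneg)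
  \<comment> \<open>At index -2 \<open>cfrac_den\<close> has the dummy value 0, but the backward
    recurrence needs 1 for \<open>Q\<close>; so index 0 is set explicitly.\<close>
  define P where "P m = (if m = 0 then 0 else real_of_int (cfrac_num ?a (int m - 2)))" for m
  define Q where "Q m = (if m = 0 then 1 else real_of_int (cfrac_den ?a (int m - 2)))" for m
  have idx: "int (Suc (Suc k)) - 2 = int k" "int (Suc k) - 2 = int k - 1" "int (Suc k) - 1 = int k" for k by simp_all
  have P_rec: "P (Suc (Suc k)) = of_int (?a k) * P (Suc k) + P k" for k
    unfolding P_def by (cases k) (simp_all del: of_nat_Suc add: idx)
  have Q_rec: "Q (Suc (Suc k)) = of_int (?a k) * Q (Suc k) + Q k" for k
    unfolding Q_def by (cases k) (simp_all del: of_nat_Suc add: idx)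
  \<comment> \<open>These unit vectors pick out the coefficients of \<open>Y 1\<close> and
    \<open>Y 0\<close>, which the two forms of d'Ocagne's identity evaluate.\<close>
  have init: "P 1 = 1" "P 0 = 0" "Q 1 = 0" "Q 0 = 1" by (simp_all add: P_def Q_def)
  have pP: "of_int (p (int n * int d + int r - 1)) = P (Suc (n * d + r))"
    and qQ: "of_int (q (int n * int d + int r - 1)) = Q (Suc (n * d + r))"
    by (simp_all add: p q P_def Q_def algebra_simps)
  have "?y (P (Suc (n * d + r))) = F (int r + 1) * hsum \<sigma> \<rho> n +
      (- 1) ^ Suc r * F (int d - int r - 1) / ?D * ?B"
    using xi_recurrence_solution[of \<alpha> \<beta>\<^sub>1 d P \<beta>\<^sub>0 r n, OF \<open>\<alpha> > 0\<close> \<open>\<beta>\<^sub>1 > 0\<close> \<open>d > 0\<close> P_rec]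
    unfolding x_def[symmetric] sr[symmetric] init fibv_dOcagne[of "int d" x r] F'
    by simp
  also have "(- 1) ^ Suc r * F (int d - int r - 1) / ?D * ?B =
      (- 1) powi (int d - int r) * F (int d - int r - 1) * F (int d) * of_int \<beta>\<^sub>1 * (\<rho> * ?B)"
    unfolding sign_p using \<open>?D \<noteq> 0\<close> by simp
  finally have eq_p: "?y (P (Suc (n * d + r))) = F (int r + 1) * hsum \<sigma> \<rho> n + \<dots>" .
  have "?y (Q (Suc (n * d + r))) = F (int r) * hsum \<sigma> \<rho> n +
      (- 1) ^ r * F (int d - int r) / ?D * ?B"
    using xi_recurrence_solution[of \<alpha> \<beta>\<^sub>1 d Q \<beta>\<^sub>0 r n, OF \<open>\<alpha> > 0\<close> \<open>\<beta>\<^sub>1 > 0\<close> \<open>d > 0\<close> Q_rec]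
    unfolding x_def[symmetric] sr[symmetric] init fibv_dOcagne'[of "int d" x r] F'
    by simp
  also have "(- 1) ^ r * F (int d - int r) / ?D * ?B =
      (- 1) powi (int d + 1 - int r) * F (int d - int r) * F (int d) * of_int \<beta>\<^sub>1 * (\<rho> * ?B)"
    unfolding sign_q using \<open>?D \<noteq> 0\<close> by simp
  finally have eq_q: "?y (Q (Suc (n * d + r))) = F (int r) * hsum \<sigma> \<rho> n + \<dots>" .
  have "convergent_of ?a (n * d + r - 1) =
      of_int (p (int n * int d + int r - 1)) / of_int (q (int n * int d + int r - 1))"
    if "n * d + r \<ge> 1"
  proof -
    \<comment> \<open>The bound keeps the subtraction on naturals from truncating.\<close>
    have "int n * int d + int r - 1 = int (n * d + r - 1)" using that by (simp add: of_nat_diff)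
    then show ?thesis using convergent_of_eq[OF pos] by (simp add: p q)
  qed
  then show ?thesis
    using eq_p eq_q unfolding pP qQ second_sum_eq_hsum hsum_def[of \<sigma> \<rho> n, symmetric] by blast
qed

end
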